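(* Over the field $GF(2)$ there is an absolute constant $C$ such that for every $n\ge 1$, every bilinear circuit over $GF(2)$ that computes the product of two $n\times n$ matrices has at least $3n^2 - C n^{5/3}$ product gates. Equivalently, the bilinear rank over $GF(2)$ of the $n^2$ bilinear forms $\{\sum_{k=1}^n x_{i,k}y_{k,j}\}_{1\le i,j\le n}$ is at least $3n^2 - Cn^{5/3}$.
   Context: The inputs are two $n\times n$ matrices of variables $x=(x_{i,j})$, $y=(y_{i,j})$, and the $n^2$ outputs are the entries $(x\cdot y)_{i,j}=\sum_{k=1}^n x_{i,k}y_{k,j}$. An arithmetic circuit over a field $F$ is a directed acyclic graph whose in-degree-0 nodes are labeled by input variables, whose edges are labeled by field constants, and whose other nodes are sum gates or product gates; a node computes the sum (resp. product) of the values of its in-neighbours, each multiplied by the constant on the connecting edge. A bilinear circuit is an arithmetic circuit in which every product gate multiplies exactly two linear forms, the first a linear form in the variables of $x$ only and the second a linear form in the variables of $y$ only. The bilinear rank of a set of bilinear forms in $x,y$ is the smallest number of products $\mu(x)\eta(y)$ (with $\mu$ linear in $x$, $\eta$ linear in $y$) whose linear span contains all of the forms. *)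

theory Defs
  imports
    Complex_Main
    "HOL-Library.Z2"
    "HOL-Library.Poly_Mapping"
    "Graph_Theory.Digraph"
begin

section \<open>Polynomials\<close>

text \<open>Formal polynomials with variables in \<open>'v\<close>: finitely supported maps from monomials
  (finitely supported exponent vectors) to coefficients.  Over \<open>GF(2)\<close> these are distinct from
  polynomial functions.\<close>

type_synonym ('v, 'f) mpolynomial = "('v \<Rightarrow>\<^sub>0 nat) \<Rightarrow>\<^sub>0 'f"

definition pvar :: "'v \<Rightarrow> ('v, 'f::field) mpolynomial" where
  "pvar z = Poly_Mapping.single (Poly_Mapping.single z 1) 1"

definition pscale :: "'f::field \<Rightarrow> ('v, 'f) mpolynomial \<Rightarrow> ('v, 'f) mpolynomial" where
  "pscale c p = Poly_Mapping.single 0 c * p"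

interpretation mpoly: vector_space "pscale :: 'f::field \<Rightarrow> ('v, 'f) mpolynomial \<Rightarrow> _"
proof
  fix a b :: 'f and p q :: "('v, 'f) mpolynomial"
  show "pscale a (p + q) = pscale a p + pscale a q"
    by (simp add: pscale_def algebra_simps)
  show "pscale (a + b) p = pscale a p + pscale b p"
    by (simp add: pscale_def single_add algebra_simps)
  show "pscale a (pscale b p) = pscale (a * b) p"
    by (simp add: pscale_def mult_single flip: mult.assoc)
  show "pscale 1 p = p"
    by (simp add: pscale_def)
qed

definition linear_form_in :: "'v set \<Rightarrow> ('v, 'f::field) mpolynomial \<Rightarrow> bool" where
  "linear_form_in V p \<longleftrightarrow> p \<in> mpoly.span (pvar ` V)"


section \<open>Arithmetic circuits\<close>

datatype 'v node_label = Input 'v | SumGate | ProdGate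

text \<open>Parallel arcs are allowed, so that a node may enter the same gate several times.\<close>

record ('a, 'b, 'v, 'f) circuit =
  dag :: "('a, 'b) pre_digraph"
  label :: "'a \<Rightarrow> 'v node_label"
  const :: "'b \<Rightarrow> 'f"

definition arith_circuit :: "'v set \<Rightarrow> ('a, 'b, 'v, 'f::field) circuit \<Rightarrow> bool" where
  "arith_circuit V G \<longleftrightarrow>
     fin_digraph (dag G) \<and> acyclic (arcs_ends (dag G)) \<and>
     (\<forall>v\<in>verts (dag G).
        if in_arcs (dag G) v = {} then label G v \<in> Input ` V
        else label G v \<in> {SumGate, ProdGate})"

text \<open>The polynomial computed at a node, by recursion along the arcs; the recursion equation is
  \<open>node_poly_eq\<close> below.\<close>

definition node_poly ::
    "('a, 'b, 'v, 'f::field) circuit \<Rightarrow> 'a \<Rightarrow> ('v, 'f) mpolynomial" where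
  "node_poly G = wfrec (arcs_ends (dag G)) (\<lambda>val v.
     case label G v of
       Input z \<Rightarrow> pvar z
     | SumGate \<Rightarrow> \<Sum>e\<in>in_arcs (dag G) v. pscale (const G e) (val (tail (dag G) e))
     | ProdGate \<Rightarrow> \<Prod>e\<in>in_arcs (dag G) v. pscale (const G e) (val (tail (dag G) e)))"

lemma node_poly_eq:
  fixes G :: "('a, 'b, 'v, 'f::field) circuit"
  assumes "arith_circuit V G"
  shows "node_poly G v =
    (case label G v of
       Input z \<Rightarrow> pvar z
     | SumGate \<Rightarrow> \<Sum>e\<in>in_arcs (dag G) v. pscale (const G e) (node_poly G (tail (dag G) e))
     | ProdGate \<Rightarrow> \<Prod>e\<in>in_arcs (dag G) v. pscale (const G e) (node_poly G (tail (dag G) e)))"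
proof -
  let ?R = "arcs_ends (dag G)"
  interpret fin_digraph "dag G" using assms by (simp add: arith_circuit_def)
  have "finite ?R" by (simp add: arcs_ends_def)
  then have wf: "wf ?R" using assms by (simp add: arith_circuit_def finite_acyclic_wf)
  have cut: "cut f ?R v (tail (dag G) e) = f (tail (dag G) e)" if "e \<in> in_arcs (dag G) v"
    for e and f :: "'a \<Rightarrow> ('v, 'f) mpolynomial"
    using that by (intro cut_apply) (auto simp: arcs_ends_conv)
  show ?thesis
    by (subst node_poly_def, subst wfrec[OF wf], fold node_poly_def)
       (simp add: cut split: node_label.split)
qed

text \<open>The factors entering a product gate are the values of the in-neighbours multiplied by the
  constants on the arcs.\<close>

definition bilinear_circuit :: "'v set \<Rightarrow> 'v set \<Rightarrow> ('a, 'b, 'v, 'f::field) circuit \<Rightarrow> bool" where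
  "bilinear_circuit X Y G \<longleftrightarrow>
     arith_circuit (X \<union> Y) G \<and>
     (\<forall>v\<in>verts (dag G). label G v = ProdGate \<longrightarrow>
        (\<exists>e e'. e \<noteq> e' \<and> in_arcs (dag G) v = {e, e'} \<and>
           linear_form_in X (pscale (const G e) (node_poly G (tail (dag G) e))) \<and>
           linear_form_in Y (pscale (const G e') (node_poly G (tail (dag G) e')))))"

definition computes ::
    "('a, 'b, 'v, 'f::field) circuit \<Rightarrow> ('v, 'f) mpolynomial set \<Rightarrow> bool" where
  "computes G F \<longleftrightarrow> F \<subseteq> node_poly G ` verts (dag G)"

definition num_prod_gates :: "('a, 'b, 'v, 'f) circuit \<Rightarrow> nat" where
  "num_prod_gates G = card {v \<in> verts (dag G). label G v = ProdGate}"


section \<open>Bilinear rank\<close>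

definition bilinear_products :: "'v set \<Rightarrow> 'v set \<Rightarrow> ('v, 'f::field) mpolynomial set" where
  "bilinear_products X Y = {\<mu> * \<eta> | \<mu> \<eta>. linear_form_in X \<mu> \<and> linear_form_in Y \<eta>}"

definition bilinear_rank ::
    "'v set \<Rightarrow> 'v set \<Rightarrow> ('v, 'f::field) mpolynomial set \<Rightarrow> nat" where
  "bilinear_rank X Y F =
     (LEAST r. \<exists>P. P \<subseteq> bilinear_products X Y \<and> finite P \<and> card P = r \<and> F \<subseteq> mpoly.span P)"


section \<open>Matrix product\<close>

datatype mat_var = XVar nat nat | YVar nat nat

definition x_vars :: "nat \<Rightarrow> mat_var set" where
  "x_vars n = {XVar i j | i j. i \<in> {1..n} \<and> j \<in> {1..n}}"

definition y_vars :: "nat \<Rightarrow> mat_var set" where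
  "y_vars n = {YVar i j | i j. i \<in> {1..n} \<and> j \<in> {1..n}}"

definition mat_prod_entry :: "nat \<Rightarrow> nat \<Rightarrow> nat \<Rightarrow> (mat_var, 'f::field) mpolynomial" where
  "mat_prod_entry n i j = (\<Sum>k=1..n. pvar (XVar i k) * pvar (YVar k j))"

definition mat_prod_forms :: "nat \<Rightarrow> (mat_var, 'f::field) mpolynomial set" where
  "mat_prod_forms n = {mat_prod_entry n i j | i j. i \<in> {1..n} \<and> j \<in> {1..n}}"

text \<open>The minimum defining the rank of the matrix product is over a nonempty set.\<close>

lemma mat_prod_forms_finite_rank:
  "\<exists>P. P \<subseteq> bilinear_products (x_vars n) (y_vars n) \<and> finite P \<and>
       (mat_prod_forms n :: (mat_var, 'f::field) mpolynomial set) \<subseteq> mpoly.span P"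
proof -
  let ?f = "\<lambda>(i, k, j). pvar (XVar i k) * pvar (YVar k j) :: (mat_var, 'f) mpolynomial"
  let ?P = "?f ` ({1..n} \<times> {1..n} \<times> {1..n})"
  have "?P \<subseteq> bilinear_products (x_vars n) (y_vars n)"
    by (fastforce simp: bilinear_products_def linear_form_in_def x_vars_def y_vars_def
        intro: mpoly.span_base)
  moreover have "mat_prod_forms n \<subseteq> mpoly.span ?P"
    unfolding mat_prod_forms_def mat_prod_entry_def
    by (clarsimp, intro mpoly.span_sum mpoly.span_base) force
  ultimately show ?thesis by blast
qed

end

theory Submission
  imports Defs "Jordan_Normal_Form.Determinant"
begin

text \<open>
  Let \<open>\<mu>\<^sub>p(X) \<eta>\<^sub>p(Y)\<close>, \<open>p \<in> P\<close>, be the products. If a matrix \<open>Z\<close> has rank \<open>r\<close>, at least \<open>n r\<close> of the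
  \<open>\<mu>\<^sub>p\<close> are nonzero at \<open>Z\<close>, since otherwise \<open>Z Y\<close> would vanish on too large a space of \<open>Y\<close>.

  A minimal subset \<open>B \<subseteq> P\<close> such that the \<open>\<mu>\<^sub>b\<close>, \<open>b \<in> B\<close>, separate matrices has at least \<open>n\<^sup>2\<close> elements
  and a dual family of matrices \<open>Z\<^sub>b\<close>, so every matrix is a sum of some \<open>Z\<^sub>b\<close>. For \<open>d\<close> matrices
  written in this way, consider the product over all their nonzero combinations of suitable
  \<open>(n - d)\<close>-minors. It is a polynomial function over \<open>GF(2)\<close> of degree at most \<open>n (2\<^sup>d - 1)\<close> in the
  coordinates, and it is nonzero at the first \<open>d\<close> powers of the nilpotent shift; hence it is nonzero
  at a point with at most \<open>n (2\<^sup>d - 1)\<close> nonzero coordinates. The \<open>d\<close>-dimensional space \<open>L\<close> of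
  matrices obtained is annihilated by all but \<open>n (2\<^sup>d - 1)\<close> of the \<open>\<mu>\<^sub>b\<close>, \<open>b \<in> B\<close>, and all its nonzero
  elements have rank at least \<open>n - d\<close>.

  Every \<open>\<mu>\<^sub>p\<close> is nonzero on at most half of \<open>L\<close>, so Plotkin's averaging argument on the products not
  annihilating \<open>L\<close> gives \<open>|P| - n\<^sup>2 + n (2\<^sup>d - 1) \<ge> 2 (1 - 2\<^bsup>-d\<^esup>) n (n - d)\<close>. With \<open>2\<^sup>d\<close> of order \<open>\<surd>n\<close>
  the total loss is \<open>O(n\<^bsup>3/2\<^esup>)\<close>.
\<close>

section \<open>Polynomial functions over GF(2)\<close>

text \<open>These rules rewrite the field operations of \<open>GF(2)\<close> to Boolean connectives, which hides
  the ring structure from the simplifier.\<close>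

declare add_bit_eq_xor [simp del] mult_bit_eq_and [simp del] minus_bit_def [simp del]
  uminus_bit_def [simp del] bit_not_zero_iff [simp del] bit_not_one_iff [simp del]

lemma bit_add_self: "a + a = (0 :: bit)"
  by (cases a) (auto simp: add_bit_eq_xor)

lemma sum_Pow_insert:
  assumes "finite S" "x \<notin> S"
  shows "(\<Sum>Q\<in>Pow (insert x S). f Q) = (\<Sum>Q\<in>Pow S. f Q + f (insert x Q))"
proof -
  have "inj_on (insert x) (Pow S)"
    using assms by (auto simp: inj_on_def)
  moreover have "Pow S \<inter> insert x ` Pow S = {}"
    using assms by auto
  ultimately show ?thesis
    using assms by (simp add: Pow_insert sum.union_disjoint sum.reindex sum.distrib)
qed

text \<open>A point of \<open>GF(2)\<^sup>V\<close> is encoded by its support \<open>Q\<close>; the monomial \<open>\<Prod>x\<in>M. x\<close> is then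
  \<open>M \<subseteq> Q\<close>.\<close>

inductive degree_le :: "nat \<Rightarrow> ('a set \<Rightarrow> bit) \<Rightarrow> bool" for D where
  zero: "degree_le D (\<lambda>_. 0)"
| monomial: "finite M \<Longrightarrow> card M \<le> D \<Longrightarrow> degree_le D (\<lambda>Q. of_bool (M \<subseteq> Q))"
| add: "degree_le D f \<Longrightarrow> degree_le D g \<Longrightarrow> degree_le D (\<lambda>Q. f Q + g Q)"

lemma degree_le_const: "degree_le D (\<lambda>_. c)"
proof (cases "c = 0")
  case True
  then show ?thesis by (simp add: degree_le.zero)
next
  case False
  then show ?thesis using degree_le.monomial[of "{}" D] by (simp add: bit_not_zero_iff)
qed

text \<open>In terms of supports, the product of the monomials of \<open>M\<close> and
  \<open>N\<close> is the monomial of \<open>M \<union> N\<close>, since the square of a variable is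
  the variable.\<close>

lemma degree_le_mult:
  assumes "degree_le D f" "degree_le E g"
  shows "degree_le (D + E) (\<lambda>Q. f Q * g Q)"
  using assms(1)
proof (induction rule: degree_le.induct)
  case zero
  then show ?case by (simp add: degree_le.zero)
next
  case (add f1 f2)
  then show ?case by (simp add: distrib_right degree_le.add)
next
  case (monomial M)
  from assms(2) show ?case
  proof (induction rule: degree_le.induct)
    case zero
    then show ?case by (simp add: degree_le.zero)
  next
    case (add g1 g2)
    then show ?case by (simp only: distrib_left degree_le.add)
  next
    case (monomial N)
    have "card (M \<union> N) \<le> D + E"
      using card_Un_le[of M N] \<open>card M \<le> D\<close> monomial by linarith
    then have "degree_le (D + E) (\<lambda>Q. of_bool (M \<union> N \<subseteq> Q))"
      using \<open>finite M\<close> monomial by (intro degree_le.monomial) auto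
    then show ?case by (simp add: of_bool_conj)
  qed
qed

lemma degree_le_sum:
  assumes "\<And>i. i \<in> I \<Longrightarrow> degree_le D (f i)"
  shows "degree_le D (\<lambda>Q. \<Sum>i\<in>I. f i Q)"
  using assms
  by (induction I rule: infinite_finite_induct) (auto intro: degree_le.zero degree_le.add)

lemma degree_le_prod:
  assumes "finite I" "\<And>i. i \<in> I \<Longrightarrow> degree_le D (f i)"
  shows "degree_le (card I * D) (\<lambda>Q. \<Prod>i\<in>I. f i Q)"
  using assms
proof (induction I)
  case empty
  then show ?case by (simp add: degree_le_const)
next
  case (insert x I)
  then show ?case by (auto intro: degree_le_mult)
qed

text \<open>Each monomial misses some \<open>x\<close> in \<open>S\<close>; toggling
  \<open>x\<close> pairs subsets with equal values, which cancel in characteristic 2.\<close>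

lemma sum_Pow_degree_le:
  assumes "degree_le D f" "finite S" "D < card S"
  shows "(\<Sum>Q\<in>Pow S. f Q) = 0"
  using assms(1)
proof (induction rule: degree_le.induct)
  case (monomial M)
  have "\<not> S \<subseteq> M"
    using monomial assms(3) card_mono[of M S] by auto
  then obtain x where x: "x \<in> S" "x \<notin> M" by auto
  then have S: "S = insert x (S - {x})" by auto
  have "(\<Sum>Q\<in>Pow S. of_bool (M \<subseteq> Q) :: bit)
      = (\<Sum>Q\<in>Pow (S - {x}). of_bool (M \<subseteq> Q) + of_bool (M \<subseteq> insert x Q))"
    using assms(2) by (subst S, subst sum_Pow_insert) auto
  also have "\<dots> = 0"
    using x by (intro sum.neutral) (auto simp: subset_insert bit_add_self)
  finally show ?case .
qed (auto simp: sum.distrib)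

text \<open>At a nonzero point of minimal weight \<open>> D\<close>, the sum over the subcube below it would be
  nonzero.\<close>

lemma degree_le_small_nonzero:
  assumes "degree_le D f" "finite A0" "f A0 \<noteq> 0"
  obtains A where "A \<subseteq> A0" "card A \<le> D" "f A \<noteq> 0"
proof -
  have "\<exists>A. A \<subseteq> A0 \<and> card A \<le> D \<and> f A \<noteq> 0"
    using assms(2,3)
  proof (induction A0 rule: finite_psubset_induct)
    case (psubset S)
    show ?case
    proof (rule ccontr)
      assume *: "\<not> ?case"
      then have "D < card S" using psubset.prems by (auto simp: not_le)
      then have "(\<Sum>Q\<in>Pow S. f Q) = 0"
        using sum_Pow_degree_le assms(1) psubset.hyps by blast
      moreover have "f Q = 0" if "Q \<in> Pow S - {S}" for Q
        using psubset.IH[of Q] that * by blast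
      ultimately have "f S = 0"
        using psubset.hyps by (subst (asm) sum.remove[of _ S]) auto
      then show False using psubset.prems by simp
    qed
  qed
  then show ?thesis using that by blast
qed

text \<open>Leibniz expansion: each term is a constant sign times \<open>m\<close> entries of degree
  at most 1.\<close>

lemma degree_le_det:
  assumes "\<And>i j. i < m \<Longrightarrow> j < m \<Longrightarrow> degree_le 1 (f i j)"
  shows "degree_le m (\<lambda>Q. det (mat m m (\<lambda>(i, j). f i j Q)))"
proof -
  have "degree_le (0 + card {0..<m} * 1) (\<lambda>Q. signof p * (\<Prod>i = 0..<m. f i (p i) Q))"
    if "p permutes {0..<m}" for p
    using that permutes_in_image[OF that]
    by (intro degree_le_mult degree_le_const degree_le_prod assms) auto
  then have "degree_le m (\<lambda>Q. \<Sum>p\<in>{p. p permutes {0..<m}}.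
      signof p * (\<Prod>i = 0..<m. f i (p i) Q))"
    by (intro degree_le_sum) auto
  moreover have "det (mat m m (\<lambda>(i, j). f i j Q)) = (\<Sum>p\<in>{p. p permutes {0..<m}}.
      signof p * (\<Prod>i = 0..<m. f i (p i) Q))" for Q
    unfolding det_def using permutes_in_image
    by (fastforce intro!: sum.cong prod.cong arg_cong2[where f = "(*)"])
  ultimately show ?thesis by simp
qed

text \<open>The matrix is the block, starting at column \<open>Min c\<close>, of a sum of powers of
  the shift. The smallest exponent gives the diagonal; the others lie strictly above it.\<close>

lemma det_shift_combination:
  assumes "finite c" "c \<noteq> {}"
  shows "det (mat m m (\<lambda>(a, k). \<Sum>i\<in>c. of_bool (Min c + k = a + i))) = (1 :: bit)" (is "det ?M = 1")
proof -
  have "(\<Sum>i\<in>c. of_bool (Min c + k = a + i)) = (0 :: bit)" if "k < a" for a k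
  proof (rule sum.neutral, rule ballI)
    fix i assume "i \<in> c"
    then have "Min c \<le> i" using assms(1) by simp
    then show "of_bool (Min c + k = a + i) = (0 :: bit)" using that by simp
  qed
  then have "upper_triangular ?M"
    by (auto simp: upper_triangular_def)
  then have "det ?M = prod_list (diag_mat ?M)"
    by (intro det_upper_triangular[of _ m]) auto
  also have "diag_mat ?M = map (\<lambda>_. 1) [0..<m]"
    unfolding diag_mat_def using assms
    by (auto simp: of_bool_def sum.delta cong: if_cong)
  also have "prod_list \<dots> = 1"
    by (simp add: map_replicate_const)
  finally show ?thesis .
qed

text \<open>Toggling an \<open>x\<close> with \<open>g x = 1\<close> injects the subsets of sum 1
  into those of sum 0; without such an \<open>x\<close> every sum is 0.\<close>

lemma card_odd_subsets_le:
  fixes g :: "'a \<Rightarrow> bit"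
  assumes "finite S"
  shows "2 * card {c \<in> Pow S. (\<Sum>i\<in>c. g i) \<noteq> 0} \<le> 2 ^ card S"
proof (cases "\<exists>x\<in>S. g x = 1")
  case False
  then have "(\<Sum>i\<in>c. g i) = 0" if "c \<in> Pow S" for c
    using that by (intro sum.neutral) (auto simp: bit_not_one_iff)
  then have "{c \<in> Pow S. (\<Sum>i\<in>c. g i) \<noteq> 0} = {}" by auto
  then show ?thesis by (metis card.empty mult_zero_right zero_le)
next
  case True
  then obtain x where x: "x \<in> S" "g x = 1" by auto
  let ?odd = "{c \<in> Pow S. (\<Sum>i\<in>c. g i) \<noteq> 0}" and ?even = "{c \<in> Pow S. (\<Sum>i\<in>c. g i) = 0}"
  let ?t = "\<lambda>c. if x \<in> c then c - {x} else insert x c"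
  have fin: "finite c" if "c \<subseteq> S" for c
    using that assms finite_subset by blast
  have "?t ` ?odd \<subseteq> ?even"
    using x by (auto simp: fin sum_diff1 bit_not_zero_iff bit_add_self)
  moreover have "inj_on ?t ?odd"
    by (auto simp: inj_on_def split: if_splits)
  ultimately have "card ?odd \<le> card ?even"
    using assms by (intro card_inj_on_le[of ?t]) simp_all
  moreover have "card ?odd + card ?even = card (Pow S)"
    using assms by (subst card_Un_disjoint[symmetric]) (auto intro: arg_cong[where f = card])
  ultimately show ?thesis
    using assms by (simp add: card_Pow)
qed

section \<open>Bilinear algorithms for the matrix product\<close>

lemma card_UNIV_bit: "card (UNIV :: bit set) = 2"
proof -
  have "(UNIV :: bit set) = {0, 1}" by (auto simp: bit_not_zero_iff)
  then show ?thesis by (metis card_2_iff zero_neq_one)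
qed

text \<open>Pigeonhole: two of the \<open>2 ^ card I\<close> assignments agree in all equations, and
  their difference is a solution.\<close>

lemma nonzero_solution_if_few_equations:
  fixes \<psi> :: "'k \<Rightarrow> 'x \<Rightarrow> bit"
  assumes "finite I" "finite K" "card K < card I"
  obtains D where "\<exists>x\<in>I. D x \<noteq> 0" "\<And>k. k \<in> K \<Longrightarrow> (\<Sum>x\<in>I. \<psi> k x * D x) = 0"
proof -
  let ?Y = "I \<rightarrow>\<^sub>E (UNIV :: bit set)"
  let ?h = "\<lambda>Y. {k \<in> K. (\<Sum>x\<in>I. \<psi> k x * Y x) = 1}"
  have "card ?Y = 2 ^ card I"
    using assms by (simp add: card_PiE card_UNIV_bit)
  moreover have "card (Pow K) = 2 ^ card K"
    using assms by (simp add: card_Pow)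
  ultimately have "card (Pow K) < card ?Y"
    using assms by simp
  moreover have "card (?h ` ?Y) \<le> card (Pow K)"
    using assms by (intro card_mono) auto
  ultimately have "\<not> inj_on ?h ?Y"
    using pigeonhole[of ?h ?Y] by linarith
  then obtain Y Y' where Y: "Y \<in> ?Y" "Y' \<in> ?Y" "Y \<noteq> Y'" "?h Y = ?h Y'"
    by (auto simp: inj_on_def)
  have "\<exists>x\<in>I. Y x - Y' x \<noteq> 0"
  proof (rule ccontr)
    assume "\<not> ?thesis"
    then have "Y x = Y' x" if "x \<in> I" for x using that by simp
    then show False using PiE_ext[OF Y(1,2)] Y(3) by simp
  qed
  moreover have "(\<Sum>x\<in>I. \<psi> k x * (Y x - Y' x)) = 0" if "k \<in> K" for k
  proof -
    have "(\<Sum>x\<in>I. \<psi> k x * Y x) = 1 \<longleftrightarrow> (\<Sum>x\<in>I. \<psi> k x * Y' x) = 1"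
      using Y(4) that by blast
    then have "(\<Sum>x\<in>I. \<psi> k x * Y x) = (\<Sum>x\<in>I. \<psi> k x * Y' x)"
      by (metis bit_not_one_iff)
    then show ?thesis by (simp add: right_diff_distrib sum_subtractf)
  qed
  ultimately show ?thesis using that[of "\<lambda>x. Y x - Y' x"] by blast
qed

text \<open>The \<open>p\<close>-th product is \<open>(\<Sum>x. u p x * X x) * (\<Sum>y. v p y * Y y)\<close>, and \<open>w p (i, j)\<close> is its
  coefficient in the entry \<open>(i, j)\<close> of \<open>XY\<close>.\<close>

locale mat_prod_algorithm =
  fixes n :: nat and P :: "'p set" and u v w :: "'p \<Rightarrow> nat \<times> nat \<Rightarrow> bit"
  assumes finite_P: "finite P"
    and decomposition: "\<lbrakk>i < n; j < n; a < n; b < n; c < n; e < n\<rbrakk> \<Longrightarrow>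
      (\<Sum>p\<in>P. w p (i, j) * u p (a, b) * v p (c, e)) = of_bool (a = i \<and> b = c \<and> e = j)"
begin

definition entries :: "(nat \<times> nat) set" where
  "entries = {..<n} \<times> {..<n}"

definition \<phi> :: "'p \<Rightarrow> (nat \<times> nat \<Rightarrow> bit) \<Rightarrow> bit" where
  "\<phi> p Z = (\<Sum>x\<in>entries. u p x * Z x)"

lemma finite_entries: "finite entries"
  by (simp add: entries_def)

lemma \<phi>_sum: "\<phi> p (\<lambda>x. \<Sum>i\<in>S. a i * f i x) = (\<Sum>i\<in>S. a i * \<phi> p (f i))"
proof -
  have "\<phi> p (\<lambda>x. \<Sum>i\<in>S. a i * f i x) = (\<Sum>x\<in>entries. \<Sum>i\<in>S. a i * (u p x * f i x))"
    by (simp add: \<phi>_def sum_distrib_left mult.left_commute)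
  also have "\<dots> = (\<Sum>i\<in>S. a i * \<phi> p (f i))"
    by (subst sum.swap) (simp add: \<phi>_def sum_distrib_left)
  finally show ?thesis .
qed

lemma \<phi>_diff: "\<phi> p (\<lambda>x. f x - g x) = \<phi> p f - \<phi> p g"
  by (simp add: \<phi>_def right_diff_distrib sum_subtractf)

text \<open>Substitute \<open>Z\<close> for \<open>X\<close>: both sides are the coefficient of
  \<open>Y (k, e)\<close> in the entry \<open>(i, j)\<close> of \<open>Z Y\<close>.\<close>

lemma contract:
  assumes "i < n" "j < n" "k < n" "e < n"
  shows "(\<Sum>p\<in>P. w p (i, j) * \<phi> p Z * v p (k, e)) = of_bool (e = j) * Z (i, k)"
proof -
  have "(\<Sum>p\<in>P. w p (i, j) * \<phi> p Z * v p (k, e))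
      = (\<Sum>p\<in>P. \<Sum>x\<in>entries. Z x * (w p (i, j) * u p x * v p (k, e)))"
    by (simp add: \<phi>_def sum_distrib_left sum_distrib_right mult_ac)
  also have "\<dots> = (\<Sum>x\<in>entries. Z x * (\<Sum>p\<in>P. w p (i, j) * u p x * v p (k, e)))"
    by (subst sum.swap) (simp add: sum_distrib_left)
  also have "\<dots> = (\<Sum>x\<in>entries. if x = (i, k) then of_bool (e = j) * Z (i, k) else 0)"
    using assms by (intro sum.cong) (auto simp: entries_def decomposition)
  also have "\<dots> = of_bool (e = j) * Z (i, k)"
    using assms by (subst sum.delta) (auto simp: entries_def)
  finally show ?thesis .
qed

text \<open>If every form vanishes at \<open>Z\<close>, then \<open>Z Y = 0\<close> for all
  \<open>Y\<close>. The column \<open>fst x\<close> serves only as some index below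
  \<open>n\<close>.\<close>

lemma \<phi>_separating:
  assumes "\<And>p. p \<in> P \<Longrightarrow> \<phi> p Z = 0" "x \<in> entries"
  shows "Z x = 0"
  using contract[of "fst x" "fst x" "snd x" "fst x" Z] assms by (auto simp: entries_def)

text \<open>If fewer than \<open>n * m\<close> forms survive at \<open>Z\<close>, their right
  factors have a common nonzero zero \<open>Y\<close> supported on rows \<open>s\<close> to
  \<open>s + m - 1\<close>. Then \<open>Z Y = 0\<close> on the first \<open>m\<close> rows, so a
  nonzero column of \<open>Y\<close> lies in the kernel of the invertible block.\<close>

lemma card_nonvanishing_ge:
  assumes "s + m \<le> n" and det: "det (mat m m (\<lambda>(i, k). Z (i, s + k))) \<noteq> 0"
  shows "n * m \<le> card {p \<in> P. \<phi> p Z \<noteq> 0}"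
proof (rule ccontr)
  let ?K = "{p \<in> P. \<phi> p Z \<noteq> 0}" and ?I = "{..<m} \<times> {..<n}"
    and ?M = "mat m m (\<lambda>(i, k). Z (i, s + k))"
  assume "\<not> ?thesis"
  then have K: "card ?K < card ?I" by (simp add: mult.commute)
  have fin: "finite ?I" "finite ?K" using finite_P by auto
  obtain D where D: "\<exists>x\<in>?I. D x \<noteq> 0"
    "\<And>p. p \<in> ?K \<Longrightarrow> (\<Sum>x\<in>?I. v p (s + fst x, snd x) * D x) = 0"
    by (rule nonzero_solution_if_few_equations[OF fin K, of "\<lambda>p x. v p (s + fst x, snd x)"]) blast
  then obtain k0 j where k0: "k0 < m" "j < n" "D (k0, j) \<noteq> 0" by auto
  let ?y = "vec m (\<lambda>k. D (k, j))"
  have "(\<Sum>k<m. Z (i, s + k) * D (k, j)) = 0" if "i < m" for i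
  proof -
    have "(\<Sum>k<m. Z (i, s + k) * D (k, j))
        = (\<Sum>k<m. \<Sum>e<n. if e = j then Z (i, s + k) * D (k, e) else 0)"
      using k0 by simp
    also have "\<dots> = (\<Sum>k<m. \<Sum>e<n. of_bool (e = j) * Z (i, s + k) * D (k, e))"
      by (intro sum.cong refl) auto
    also have "\<dots> = (\<Sum>x\<in>?I. of_bool (snd x = j) * Z (i, s + fst x) * D x)"
      by (simp add: sum.cartesian_product case_prod_unfold)
    also have "\<dots> = (\<Sum>x\<in>?I. (\<Sum>p\<in>P. w p (i, j) * \<phi> p Z * v p (s + fst x, snd x)) * D x)"
      using that assms(1) k0 by (intro sum.cong refl) (auto simp: contract)
    also have "\<dots> = (\<Sum>x\<in>?I. \<Sum>p\<in>P. w p (i, j) * \<phi> p Z * (v p (s + fst x, snd x) * D x))"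
      by (simp add: sum_distrib_right mult.assoc)
    also have "\<dots> = (\<Sum>p\<in>P. w p (i, j) * \<phi> p Z * (\<Sum>x\<in>?I. v p (s + fst x, snd x) * D x))"
      by (subst sum.swap) (simp add: sum_distrib_left)
    also have "\<dots> = 0"
      using D(2) by (intro sum.neutral) auto
    finally show ?thesis .
  qed
  then have "?M *\<^sub>v ?y = 0\<^sub>v m"
    by (intro eq_vecI) (auto simp: scalar_prod_def atLeast0LessThan)
  moreover have "?y \<noteq> 0\<^sub>v m"
    using k0 by (metis index_vec index_zero_vec(1))
  ultimately have "det ?M = 0"
    by (subst det_0_iff_vec_prod_zero[of _ m]) (auto intro!: exI[of _ ?y])
  with det show False by simp
qed

section \<open>Dual bases and sparse spaces of high-rank matrices\<close>

lemma obtain_dual_matrices: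
  obtains B Zb where "B \<subseteq> P" "n * n \<le> card B"
    "\<forall>b\<in>B. \<forall>b'\<in>B. \<phi> b' (Zb b) = of_bool (b = b')"
    "\<forall>Z. \<forall>x\<in>entries. Z x = (\<Sum>b\<in>B. \<phi> b Z * Zb b x)"
proof -
  define sep where "sep S \<longleftrightarrow> S \<subseteq> P \<and> (\<forall>Z. (\<forall>p\<in>S. \<phi> p Z = 0) \<longrightarrow> (\<forall>x\<in>entries. Z x = 0))" for S
  have "sep P" using \<phi>_separating by (auto simp: sep_def)
  then obtain B where B: "sep B" "\<And>S. sep S \<Longrightarrow> card B \<le> card S"
    using ex_has_least_nat[of sep P card] by auto
  then have BP: "B \<subseteq> P" and fB: "finite B"
    using finite_P finite_subset by (auto simp: sep_def)
  have "\<exists>Z. \<forall>b'\<in>B. \<phi> b' Z = of_bool (b = b')" if "b \<in> B" for b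
  proof -
    \<comment> \<open>Minimality yields a matrix killed by all of \<open>B\<close> except
      \<open>b\<close>; its value at \<open>b\<close> is 1, the only nonzero scalar.\<close>
    have "\<not> sep (B - {b})"
      using B(2)[of "B - {b}"] that fB by (metis card_Diff1_less not_le)
    then obtain Z x where Z: "\<And>p. p \<in> B - {b} \<Longrightarrow> \<phi> p Z = 0" "x \<in> entries" "Z x \<noteq> 0"
      using BP unfolding sep_def by blast
    have "\<phi> b Z \<noteq> 0"
      using B(1) Z unfolding sep_def by (metis DiffI singletonD)
    then show ?thesis
      using Z(1) by (intro exI[of _ Z]) (auto simp: bit_not_zero_iff)
  qed
  then obtain Zb where Zb: "\<And>b b'. b \<in> B \<Longrightarrow> b' \<in> B \<Longrightarrow> \<phi> b' (Zb b) = of_bool (b = b')"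
    by metis
  have "n * n \<le> card B"
  proof (rule ccontr)
    assume "\<not> ?thesis"
    then have "card B < card entries" by (simp add: entries_def)
    then obtain D where "\<exists>x\<in>entries. D x \<noteq> 0" "\<And>b. b \<in> B \<Longrightarrow> \<phi> b D = 0"
      using nonzero_solution_if_few_equations[OF finite_entries fB, of u] unfolding \<phi>_def by metis
    then show False using B(1) by (auto simp: sep_def)
  qed
  moreover have "Z x = (\<Sum>b\<in>B. \<phi> b Z * Zb b x)" if "x \<in> entries" for Z x
  proof -
    \<comment> \<open>The remainder of the expansion is killed by all of \<open>B\<close>, hence is
      zero on \<open>entries\<close>.\<close>
    have "\<phi> p (\<lambda>x. Z x - (\<Sum>b\<in>B. \<phi> b Z * Zb b x)) = 0" if "p \<in> B" for p
      using that fB by (simp add: \<phi>_diff \<phi>_sum Zb)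
    then have "Z x - (\<Sum>b\<in>B. \<phi> b Z * Zb b x) = 0"
      using B(1) \<open>x \<in> entries\<close> unfolding sep_def by blast
    then show ?thesis by simp
  qed
  ultimately show ?thesis using that BP Zb by blast
qed

lemma obtain_sparse_code:
  assumes "d \<le> n"
  obtains B T Z where "B \<subseteq> P" "n * n \<le> card B" "finite T" "card T \<le> (2 ^ d - 1) * n"
    "\<And>p i. p \<in> B - T \<Longrightarrow> \<phi> p (Z i) = 0"
    "\<And>c. c \<subseteq> {..<d} \<Longrightarrow> c \<noteq> {} \<Longrightarrow> n * (n - d) \<le> card {p \<in> P. (\<Sum>i\<in>c. \<phi> p (Z i)) \<noteq> 0}"
proof -
  obtain B Zb where B: "B \<subseteq> P" "n * n \<le> card B"
    and dual: "\<forall>b\<in>B. \<forall>b'\<in>B. \<phi> b' (Zb b) = of_bool (b = b')"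
    and expand: "\<forall>Z. \<forall>x\<in>entries. Z x = (\<Sum>b\<in>B. \<phi> b Z * Zb b x)"
    by (rule obtain_dual_matrices)
  have fB: "finite B" using B finite_P finite_subset by blast
  let ?m = "n - d" and ?C = "Pow {..<d} - {{}}"
  \<comment> \<open>\<open>A\<close> is the support of a point: \<open>(b, i) \<in> A\<close> means
    that \<open>Zb b\<close> occurs in the \<open>i\<close>-th matrix.\<close>
  define Z where "Z A i x = (\<Sum>b\<in>B. of_bool ((b, i) \<in> A) * Zb b x)" for A and i :: nat and x
  \<comment> \<open>The minor for \<open>c\<close> starts at column \<open>Min c\<close>, where the
    same combination of shift powers is unitriangular; \<open>Min c < d\<close> keeps it inside the
    matrix.\<close>
  define F where "F A = (\<Prod>c\<in>?C. det (mat ?m ?m (\<lambda>(a, k). \<Sum>i\<in>c. Z A i (a, Min c + k))))" for A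
  \<comment> \<open>Powers of the nilpotent shift, starting with the identity; \<open>A0\<close>
    records their coordinates in the dual family.\<close>
  define N :: "nat \<Rightarrow> nat \<times> nat \<Rightarrow> bit" where "N i = (\<lambda>(a, b). of_bool (b = a + i))" for i
  define A0 where "A0 = {(b, i) \<in> B \<times> {..<d}. \<phi> b (N i) \<noteq> 0}"
  have Min_less: "Min c < d" if "c \<in> ?C" for c
  proof -
    have "Min c \<in> c"
      using that finite_subset[of c "{..<d}"] by (intro Min_in) auto
    then have "Min c \<in> {..<d}" using that by blast
    then show ?thesis by simp
  qed
  have var: "degree_le 1 (\<lambda>A. of_bool (y \<in> A) * z)" for y :: "'p \<times> nat" and z
    using degree_le_mult[OF degree_le.monomial[of "{y}" 1] degree_le_const[of 0 z]] by simp
  have "degree_le (card ?C * ?m) F"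
    unfolding F_def Z_def by (intro degree_le_prod degree_le_det degree_le_sum var) auto
  moreover have "finite A0"
    using fB by (auto simp: A0_def intro: finite_subset[of _ "B \<times> {..<d}"])
  moreover have "F A0 = 1"
  proof -
    have Z_N: "Z A0 i x = N i x" if "i < d" "x \<in> entries" for i x
    proof -
      have "Z A0 i x = (\<Sum>b\<in>B. \<phi> b (N i) * Zb b x)"
        unfolding Z_def using that
        by (intro sum.cong refl) (auto simp: A0_def bit_not_zero_iff)
      then show ?thesis using expand[rule_format, of x "N i"] that(2) by simp
    qed
    have "det (mat ?m ?m (\<lambda>(a, k). \<Sum>i\<in>c. Z A0 i (a, Min c + k))) = 1" if c: "c \<in> ?C" for c
    proof -
      have "Z A0 i (a, Min c + k) = of_bool (Min c + k = a + i)"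
        if "i \<in> c" "a < ?m" "k < ?m" for i a k
      proof -
        have "i < d" using that c by blast
        moreover have "a < n" "Min c + k < n" using that Min_less[OF c] by linarith+
        ultimately show ?thesis
          using Z_N[of i "(a, Min c + k)"] by (simp add: N_def entries_def)
      qed
      then have "mat ?m ?m (\<lambda>(a, k). \<Sum>i\<in>c. Z A0 i (a, Min c + k))
          = mat ?m ?m (\<lambda>(a, k). \<Sum>i\<in>c. of_bool (Min c + k = a + i))"
        by (intro eq_matI) auto
      then show ?thesis
        using det_shift_combination[of c ?m] c finite_subset[of c "{..<d}"] by auto
    qed
    then show ?thesis by (simp add: F_def)
  qed
  ultimately obtain A where A: "A \<subseteq> A0" "card A \<le> card ?C * ?m" "F A \<noteq> 0"
    using degree_le_small_nonzero[of "card ?C * ?m" F A0] by auto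
  have "finite A" using A(1) \<open>finite A0\<close> finite_subset by blast
  \<comment> \<open>Forgetting \<open>i\<close> leaves the indices \<open>b\<close> used by any of
    the matrices; this set is the \<open>T\<close> of the statement.\<close>
  have "card (fst ` A) \<le> card ?C * ?m"
    using card_image_le[OF \<open>finite A\<close>, of fst] A(2) by linarith
  also have "card ?C = 2 ^ d - 1"
    by (simp add: card_Pow)
  also have "(2 ^ d - 1) * (n - d) \<le> (2 ^ d - 1) * n"
    by simp
  finally have card_T: "card (fst ` A) \<le> (2 ^ d - 1) * n" .
  have "\<phi> p (Z A i) = 0" if "p \<in> B - fst ` A" for p i
  proof -
    have "\<phi> p (Z A i) = (\<Sum>b\<in>B. of_bool ((b, i) \<in> A) * \<phi> p (Zb b))"
      unfolding Z_def by (rule \<phi>_sum)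
    also have "\<dots> = 0"
      using that by (intro sum.neutral) (force simp: dual)
    finally show ?thesis .
  qed
  moreover have "n * (n - d) \<le> card {p \<in> P. (\<Sum>i\<in>c. \<phi> p (Z A i)) \<noteq> 0}"
    if "c \<subseteq> {..<d}" "c \<noteq> {}" for c
  proof -
    have c: "c \<in> ?C" using that by auto
    have "det (mat ?m ?m (\<lambda>(a, k). \<Sum>i\<in>c. Z A i (a, Min c + k))) \<noteq> 0"
      using A(3) c by (auto simp: F_def)
    then have "n * (n - d) \<le> card {p \<in> P. \<phi> p (\<lambda>x. \<Sum>i\<in>c. Z A i x) \<noteq> 0}"
      using Min_less[OF c] assms by (intro card_nonvanishing_ge[of "Min c"]) auto
    moreover have "\<phi> p (\<lambda>x. \<Sum>i\<in>c. Z A i x) = (\<Sum>i\<in>c. \<phi> p (Z A i))" for p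
      using \<phi>_sum[of p "\<lambda>_. 1" "Z A" c] by simp
    ultimately show ?thesis by simp
  qed
  ultimately show ?thesis
    using that[of B "fst ` A" "Z A"] B card_T \<open>finite A\<close> by auto
qed

section \<open>Averaging over the space and choice of its dimension\<close>

text \<open>Double counting of pairs of a nonempty combination \<open>c\<close> and a product
  \<open>p\<close> whose form is nonzero on it. The bound is multiplied by \<open>2 ^ d\<close> and
  the loss moved to the right, so that it can be stated in natural numbers.\<close>

lemma card_algorithm_ge:
  assumes "d \<le> n"
  shows "2 * ((2 ^ d - 1) * (n * (n - d))) + 2 ^ d * (n * n) \<le> 2 ^ d * (card P + (2 ^ d - 1) * n)"
proof -
  obtain B T Z where B: "B \<subseteq> P" "n * n \<le> card B" and T: "finite T" "card T \<le> (2 ^ d - 1) * n"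
    and zero: "\<And>p i. p \<in> B - T \<Longrightarrow> \<phi> p (Z i) = 0"
    and weight: "\<And>c. c \<subseteq> {..<d} \<Longrightarrow> c \<noteq> {} \<Longrightarrow>
      n * (n - d) \<le> card {p \<in> P. (\<Sum>i\<in>c. \<phi> p (Z i)) \<noteq> 0}"
    by (rule obtain_sparse_code[OF assms]) blast
  let ?C = "Pow {..<d} - {{}}" and ?R = "P - (B - T)"
  let ?nz = "\<lambda>p c. (\<Sum>i\<in>c. \<phi> p (Z i)) \<noteq> 0"
  have card_bool: "card {x \<in> S. Q x} = (\<Sum>x\<in>S. of_bool (Q x))" if "finite S" for Q and S :: "'x set"
    using that by (simp add: Int_def)
  have "card ?C = 2 ^ d - 1"
    by (simp add: card_Pow)
  then have "(2 ^ d - 1) * (n * (n - d)) = (\<Sum>c\<in>?C. n * (n - d))"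
    by simp
  also have "\<dots> \<le> (\<Sum>c\<in>?C. card {p \<in> P. ?nz p c})"
    using weight by (intro sum_mono) auto
  also have "\<dots> = (\<Sum>p\<in>P. card {c \<in> ?C. ?nz p c})"
    using finite_P by (simp only: card_bool finite_Diff finite_Pow_iff finite_lessThan) (rule sum.swap)
  \<comment> \<open>The forms in \<open>B - T\<close> vanish on the whole space and contribute
    nothing.\<close>
  also have "\<dots> = (\<Sum>p\<in>?R. card {c \<in> ?C. ?nz p c})"
    using zero finite_P by (intro sum.mono_neutral_right) auto
  finally have "2 * ((2 ^ d - 1) * (n * (n - d))) \<le> (\<Sum>p\<in>?R. 2 * card {c \<in> ?C. ?nz p c})"
    by (simp add: sum_distrib_left[symmetric])
  also have "\<dots> \<le> (\<Sum>p\<in>?R. 2 ^ d)"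
  proof (rule sum_mono)
    fix p
    have "card {c \<in> ?C. ?nz p c} \<le> card {c \<in> Pow {..<d}. ?nz p c}"
      by (intro card_mono) auto
    then show "2 * card {c \<in> ?C. ?nz p c} \<le> 2 ^ d"
      using card_odd_subsets_le[of "{..<d}" "\<lambda>i. \<phi> p (Z i)"] by simp
  qed
  also have "\<dots> = 2 ^ d * card ?R"
    by simp
  finally have "2 * ((2 ^ d - 1) * (n * (n - d))) + 2 ^ d * (n * n) \<le> 2 ^ d * (card ?R + n * n)"
    by (simp add: distrib_left)
  also have "card ?R + n * n \<le> card P + (2 ^ d - 1) * n"
  proof -
    have "card ?R = card P - card (B - T)"
      using B finite_P finite_subset by (intro card_Diff_subset) blast+
    moreover have "card (B - T) \<le> card P"
      using B finite_P by (intro card_mono) auto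
    moreover have "card B - card T \<le> card (B - T)"
      by (rule diff_card_le_card_Diff[OF T(1)])
    ultimately show ?thesis using B(2) T(2) by linarith
  qed
  finally show ?thesis by simp
qed

end


text \<open>Choosing \<open>d\<close> with \<open>4 ^ d \<le> n < 4 ^ (d + 1)\<close> makes
  \<open>q = 2 ^ d\<close> agree with \<open>r = sqrt n\<close> up to a factor 2, which balances the
  loss from averaging against that from sparsity.\<close>

lemma (in mat_prod_algorithm) card_algorithm_ge_real:
  assumes "n \<ge> 1"
  shows "real (card P) \<ge> 3 * real n ^ 2 - 7 * real n powr (5 / 3)"
proof -
  obtain d where d: "4 ^ d \<le> n" "n < 4 ^ (d + 1)"
    using ex_power_ivl1[of 4 n] assms by auto
  define q r where "q = (2 ^ d :: real)" and "r = sqrt (real n)"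
  have q: "q \<ge> 1" "real d \<le> q"
    using of_nat_mono[OF less_imp_le[OF less_exp[of d]], where 'a = real] by (auto simp: q_def)
  have r2: "real n = r ^ 2" by (simp add: r_def)
  have "q ^ 2 = 4 ^ d"
    by (simp add: q_def power2_eq_square flip: power_mult_distrib)
  then have "q ^ 2 \<le> real n" "real n \<le> 4 * q ^ 2"
    using of_nat_mono[OF d(1), where 'a = real] of_nat_mono[OF less_imp_le[OF d(2)], where 'a = real]
    by auto
  then have qr: "q \<le> r" "r \<le> 2 * q"
    using q(1) unfolding r_def by (auto intro!: real_le_rsqrt real_le_lsqrt simp: power_mult_distrib)
  have "d \<le> n"
    using d(1) less_exp[of d] power_mono[of "2::nat" 4 d] by linarith
  have "real (2 * ((2 ^ d - 1) * (n * (n - d))) + 2 ^ d * (n * n))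
      \<le> real (2 ^ d * (card P + (2 ^ d - 1) * n))"
    using card_algorithm_ge[OF \<open>d \<le> n\<close>] of_nat_mono by blast
  moreover have "real (2 ^ d - 1) = q - 1"
    by (simp add: of_nat_diff q_def)
  moreover have "real (n - d) = r ^ 2 - real d"
    using \<open>d \<le> n\<close> r2 by (simp add: of_nat_diff)
  moreover have "real (2 ^ d) = q"
    by (simp add: q_def)
  ultimately have main: "2 * (q - 1) * (r ^ 2 * (r ^ 2 - real d)) + q * (r ^ 2 * r ^ 2)
      \<le> q * (real (card P) + (q - 1) * r ^ 2)"
    by (simp only: of_nat_add of_nat_mult of_nat_numeral r2 mult.assoc)
  \<comment> \<open>The constant is 7 = 4 + 2 + 1: after division by \<open>q\<close>, the losses
    \<open>2 * r ^ 4 / q\<close>, \<open>2 * (q - 1) * d * r ^ 2 / q\<close> and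
    \<open>(q - 1) * r ^ 2\<close> are at most 4, 2 and 1 times \<open>r ^ 3\<close>.\<close>
  have "q * (3 * r ^ 4 - 7 * r ^ 3) \<le> q * real (card P)"
  proof -
    have "r ^ 2 * (2 * r ^ 2) \<le> r ^ 2 * (4 * q * r)"
      using qr q by (intro mult_left_mono) (auto simp: power2_eq_square intro!: mult_right_mono)
    moreover have "(q - 1) * (r ^ 2 * real d) \<le> q * (r ^ 2 * r)"
      using qr q by (intro mult_mono) auto
    moreover have "q * (r ^ 2 * (q - 1)) \<le> q * (r ^ 2 * r)"
      using qr q by (intro mult_left_mono) auto
    ultimately show ?thesis
      using main by (simp add: algebra_simps power2_eq_square power3_eq_cube power4_eq_xxxx)
  qed
  then have "3 * r ^ 4 - 7 * r ^ 3 \<le> real (card P)"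
    using q(1) by simp
  moreover have "r ^ 4 = real n ^ 2"
    by (simp add: r2)
  moreover have "r ^ 3 \<le> real n powr (5 / 3)"
  proof -
    have "r ^ 3 = real n powr (3 / 2)"
      using assms by (simp add: r_def powr_half_sqrt[symmetric] powr_power)
    also have "\<dots> \<le> real n powr (5 / 3)"
      using assms by (intro powr_mono) auto
    finally show ?thesis .
  qed
  ultimately show ?thesis by linarith
qed

section \<open>Coefficients of bilinear forms\<close>

abbreviation mono2 :: "'v \<Rightarrow> 'v \<Rightarrow> 'v \<Rightarrow>\<^sub>0 nat" where
  "mono2 x y \<equiv> Poly_Mapping.single x 1 + Poly_Mapping.single y 1"

lemma lookup_pscale:
  fixes p :: "('v, bit) mpolynomial"
  shows "Poly_Mapping.lookup (pscale c p) m = c * Poly_Mapping.lookup p m"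
  by (cases c) (auto simp: pscale_def)

lemma pscale_mult_left: "pscale c p * q = pscale c (p * q)"
  by (simp add: pscale_def mult.assoc)

lemma pscale_mult_right: "p * pscale c q = pscale c (p * q)"
  by (simp add: pscale_def mult.left_commute)

text \<open>Disjointness of \<open>X\<close> and \<open>Y\<close> excludes an exchange of the two
  variables.\<close>

lemma mono2_eq_iff:
  assumes "a \<in> X" "x \<in> X" "b \<in> Y" "y \<in> Y" "X \<inter> Y = {}"
  shows "mono2 a b = mono2 x y \<longleftrightarrow> a = x \<and> b = y"
proof
  assume "mono2 a b = mono2 x y"
  then have "Poly_Mapping.lookup (mono2 a b) z = Poly_Mapping.lookup (mono2 x y) z" for z by simp
  from this[of x] this[of y] show "a = x \<and> b = y"
    using assms by (auto simp: lookup_add lookup_single when_def split: if_splits)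
qed simp

lemma lookup_pvar_mult_pvar:
  assumes "a \<in> X" "x \<in> X" "b \<in> Y" "y \<in> Y" "X \<inter> Y = {}"
  shows "Poly_Mapping.lookup (pvar a * pvar b :: ('v, bit) mpolynomial) (mono2 x y) = of_bool (a = x \<and> b = y)"
  using mono2_eq_iff[OF assms]
  by (auto simp: pvar_def mult_single lookup_single when_def)

lemma lookup_pvar_single:
  "Poly_Mapping.lookup (pvar a :: ('v, bit) mpolynomial) (Poly_Mapping.single x 1) = of_bool (a = x)"
proof -
  have "Poly_Mapping.single a (1 :: nat) = Poly_Mapping.single x 1 \<longleftrightarrow> a = x"
    by (metis lookup_single_eq lookup_single_not_eq zero_neq_one)
  then show ?thesis by (simp add: pvar_def lookup_single when_def)
qed

text \<open>Both sides are linear in each factor, so span induction, first on \<open>\<eta>\<close>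
  and then on \<open>\<mu>\<close>, reduces the claim to variables.\<close>

lemma lookup_linear_mult_linear:
  fixes \<mu> \<eta> :: "('v, bit) mpolynomial"
  assumes \<mu>: "linear_form_in X \<mu>" and \<eta>: "linear_form_in Y \<eta>"
    and xy: "x \<in> X" "y \<in> Y" "X \<inter> Y = {}"
  shows "Poly_Mapping.lookup (\<mu> * \<eta>) (mono2 x y)
    = Poly_Mapping.lookup \<mu> (Poly_Mapping.single x 1) * Poly_Mapping.lookup \<eta> (Poly_Mapping.single y 1)"
proof -
  have var: "Poly_Mapping.lookup (pvar a * \<eta>) (mono2 x y)
      = of_bool (a = x) * Poly_Mapping.lookup \<eta> (Poly_Mapping.single y 1)" if "a \<in> X" for a
    using \<eta>[unfolded linear_form_in_def]
  proof (induction rule: mpoly.span_induct_alt)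
    case base
    then show ?case by simp
  next
    case (step c b q)
    then show ?case
      using that xy
      by (auto simp: distrib_left pscale_mult_right lookup_add lookup_pscale
          lookup_pvar_mult_pvar[of _ X _ _ Y] lookup_pvar_single simp del: One_nat_def)
  qed
  show ?thesis
    using \<mu>[unfolded linear_form_in_def]
  proof (induction rule: mpoly.span_induct_alt)
    case base
    then show ?case by simp
  next
    case (step c a p)
    then show ?case
      by (auto simp: distrib_right pscale_mult_left lookup_add lookup_pscale var
          lookup_pvar_single mult.assoc simp del: One_nat_def)
  qed
qed

text \<open>Shows that linear terms, which sum gates may add from inputs, do not affect the bilinear
  coefficients.\<close>

lemma lookup_linear_mono2:
  fixes q :: "('v, bit) mpolynomial"
  assumes "linear_form_in V q" "x \<noteq> y"
  shows "Poly_Mapping.lookup q (mono2 x y) = 0"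
  using assms(1)[unfolded linear_form_in_def]
proof (induction rule: mpoly.span_induct_alt)
  case base
  then show ?case by simp
next
  case (step c a p)
  have "Poly_Mapping.single z 1 \<noteq> mono2 x y" for z :: 'v
  proof
    assume "Poly_Mapping.single z 1 = mono2 x y"
    then have "Poly_Mapping.lookup (Poly_Mapping.single z 1) t = Poly_Mapping.lookup (mono2 x y) t" for t by simp
    from this[of x] this[of y] show False
      using assms(2) by (auto simp: lookup_add lookup_single when_def split: if_splits)
  qed
  then show ?case
    using step by (auto simp: lookup_add lookup_pscale pvar_def lookup_single when_def
        simp del: One_nat_def)
qed

lemma lookup_mat_prod_entry:
  assumes "i \<in> {1..n}" "j \<in> {1..n}" "a \<in> {1..n}" "b \<in> {1..n}" "c \<in> {1..n}" "e \<in> {1..n}"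
  shows "Poly_Mapping.lookup (mat_prod_entry n i j :: (mat_var, bit) mpolynomial) (mono2 (XVar a b) (YVar c e))
    = of_bool (a = i \<and> b = c \<and> e = j)"
proof -
  have "Poly_Mapping.lookup (mat_prod_entry n i j :: (mat_var, bit) mpolynomial) (mono2 (XVar a b) (YVar c e))
      = (\<Sum>k = 1..n. of_bool (XVar i k = XVar a b \<and> YVar k j = YVar c e))"
    unfolding mat_prod_entry_def lookup_sum
    by (intro sum.cong refl
        lookup_pvar_mult_pvar[of _ "range (case_prod XVar)" _ _ "range (case_prod YVar)"])
       auto
  also have "\<dots> = (\<Sum>k = 1..n. if k = b then of_bool (a = i \<and> b = c \<and> e = j) else 0)"
    by (intro sum.cong refl) auto
  also have "\<dots> = of_bool (a = i \<and> b = c \<and> e = j)"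
    using assms by (subst sum.delta) auto
  finally show ?thesis .
qed

text \<open>Compare the coefficients of each monomial \<open>x y\<close> in the expansions of the
  entries. \<open>Suc\<close> translates indices below \<open>n\<close> into those of the variables,
  which start at 1.\<close>

lemma obtain_mat_prod_algorithm:
  fixes P :: "(mat_var, bit) mpolynomial set"
  assumes P: "P \<subseteq> bilinear_products (x_vars n) (y_vars n)" "finite P"
    and span: "mat_prod_forms n \<subseteq> mpoly.span (P \<union> pvar ` V)"
  obtains u v w where "mat_prod_algorithm n P u v w"
proof -
  have "\<forall>p\<in>P. \<exists>\<mu> \<eta>. p = \<mu> * \<eta> \<and> linear_form_in (x_vars n) \<mu> \<and> linear_form_in (y_vars n) \<eta>"
    using P(1) by (auto simp: bilinear_products_def)
  then obtain \<mu> \<eta> where factors: "\<And>p. p \<in> P \<Longrightarrow> p = \<mu> p * \<eta> p"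
    "\<And>p. p \<in> P \<Longrightarrow> linear_form_in (x_vars n) (\<mu> p)" "\<And>p. p \<in> P \<Longrightarrow> linear_form_in (y_vars n) (\<eta> p)"
    by metis
  define expansion where "expansion i j g q \<longleftrightarrow> linear_form_in V q \<and>
      mat_prod_entry n (Suc i) (Suc j) = (\<Sum>p\<in>P. pscale (g p) p) + q" for i j g q
  have "\<exists>g q. expansion i j g q" if "i < n" "j < n" for i j
  proof -
    have "mat_prod_entry n (Suc i) (Suc j) \<in> (mat_prod_forms n :: (mat_var, bit) mpolynomial set)"
      using that by (force simp: mat_prod_forms_def)
    then show ?thesis
      using span P(2)
      by (auto simp: expansion_def mpoly.span_Un mpoly.span_finite linear_form_in_def) blast
  qed
  then obtain g q where gq: "\<And>i j. i < n \<Longrightarrow> j < n \<Longrightarrow> expansion i j (g i j) (q i j)"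
    by metis
  let ?u = "\<lambda>p (a, b). Poly_Mapping.lookup (\<mu> p) (Poly_Mapping.single (XVar (Suc a) (Suc b)) 1)"
  let ?v = "\<lambda>p (c, e). Poly_Mapping.lookup (\<eta> p) (Poly_Mapping.single (YVar (Suc c) (Suc e)) 1)"
  let ?w = "\<lambda>p (i, j). g i j p"
  have "mat_prod_algorithm n P ?u ?v ?w"
  proof
    fix i j a b c e
    assume lt: "i < n" "j < n" "a < n" "b < n" "c < n" "e < n"
    let ?x = "XVar (Suc a) (Suc b)" and ?y = "YVar (Suc c) (Suc e)"
    have xy: "?x \<in> x_vars n" "?y \<in> y_vars n" "x_vars n \<inter> y_vars n = {}"
      using lt by (auto simp: x_vars_def y_vars_def)
    have p: "Poly_Mapping.lookup p (mono2 ?x ?y) = ?u p (a, b) * ?v p (c, e)" if "p \<in> P" for p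
      using lookup_linear_mult_linear[OF factors(2,3)[OF that] xy] factors(1)[OF that] by simp
    have "of_bool (a = i \<and> b = c \<and> e = j)
        = Poly_Mapping.lookup (mat_prod_entry n (Suc i) (Suc j) :: (mat_var, bit) mpolynomial) (mono2 ?x ?y)"
      using lt by (subst lookup_mat_prod_entry) auto
    also have "\<dots> = (\<Sum>p\<in>P. g i j p * Poly_Mapping.lookup p (mono2 ?x ?y))"
      using gq[OF lt(1,2), unfolded expansion_def] lookup_linear_mono2[of V "q i j" ?x ?y]
      by (simp add: lookup_add lookup_sum lookup_pscale)
    also have "\<dots> = (\<Sum>p\<in>P. ?w p (i, j) * ?u p (a, b) * ?v p (c, e))"
      by (intro sum.cong refl) (simp only: p prod.case mult.assoc)
    finally show "(\<Sum>p\<in>P. ?w p (i, j) * ?u p (a, b) * ?v p (c, e)) = of_bool (a = i \<and> b = c \<and> e = j)"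
      by simp
  qed (fact P(2))
  then show ?thesis using that by blast
qed

section \<open>Circuits\<close>

text \<open>Induction along the arcs: inputs and product gates are generators, and sum gates form
  linear combinations.\<close>

lemma node_poly_in_span:
  assumes G: "arith_circuit V G" and v: "v \<in> verts (dag G)"
  shows "node_poly G v \<in>
    mpoly.span (node_poly G ` {v \<in> verts (dag G). label G v = ProdGate} \<union> pvar ` V)"
    (is "_ \<in> mpoly.span ?S")
proof -
  interpret fin_digraph "dag G" using G by (simp add: arith_circuit_def)
  have "finite (arcs_ends (dag G))" by (simp add: arcs_ends_def)
  then have "wf (arcs_ends (dag G))" using G by (simp add: arith_circuit_def finite_acyclic_wf)
  then show ?thesis
    using v
  proof (induction v)
    case (less v)
    have label: "if in_arcs (dag G) v = {} then label G v \<in> Input ` V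
        else label G v \<in> {SumGate, ProdGate}"
      using G less.prems unfolding arith_circuit_def by blast
    show ?case
    proof (cases "label G v")
      case (Input z)
      then have "node_poly G v = pvar z" "z \<in> V"
        using label node_poly_eq[OF G, of v] by (auto split: if_splits)
      then show ?thesis by (auto intro: mpoly.span_base)
    next
      case ProdGate
      then show ?thesis using less.prems by (auto intro: mpoly.span_base)
    next
      case SumGate
      have "node_poly G (tail (dag G) e) \<in> mpoly.span ?S" if "e \<in> in_arcs (dag G) v" for e
        using that less.IH[of "tail (dag G) e"] by (auto simp: arcs_ends_conv)
      then show ?thesis
        unfolding node_poly_eq[OF G, of v] SumGate
        by (auto intro!: mpoly.span_sum mpoly.span_scale)
    qed
  qed
qed

lemma prod_gate_in_bilinear_products:
  assumes "bilinear_circuit X Y G" "v \<in> verts (dag G)" "label G v = ProdGate"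
  shows "node_poly G v \<in> bilinear_products X Y"
proof -
  obtain e e' where e: "e \<noteq> e'" "in_arcs (dag G) v = {e, e'}"
    "linear_form_in X (pscale (const G e) (node_poly G (tail (dag G) e)))"
    "linear_form_in Y (pscale (const G e') (node_poly G (tail (dag G) e')))"
    using assms unfolding bilinear_circuit_def by blast
  have "arith_circuit (X \<union> Y) G" using assms(1) by (simp add: bilinear_circuit_def)
  then have "node_poly G v = pscale (const G e) (node_poly G (tail (dag G) e))
      * pscale (const G e') (node_poly G (tail (dag G) e'))"
    using node_poly_eq[of "X \<union> Y" G v] e(1,2) assms(3) by simp
  then show ?thesis using e(3,4) by (auto simp: bilinear_products_def)
qed

text \<open>Common source of both bounds: \<open>V\<close> is the set of all variables for circuits
  and empty for the rank.\<close>

lemma card_products_ge: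
  fixes P :: "(mat_var, bit) mpolynomial set"
  assumes "n \<ge> 1" "P \<subseteq> bilinear_products (x_vars n) (y_vars n)" "finite P"
    "mat_prod_forms n \<subseteq> mpoly.span (P \<union> pvar ` V)"
  shows "real (card P) \<ge> 3 * real n ^ 2 - 7 * real n powr (5 / 3)"
  using assms obtain_mat_prod_algorithm mat_prod_algorithm.card_algorithm_ge_real by metis

lemma num_prod_gates_ge:
  fixes G :: "('a, 'b, mat_var, bit) circuit"
  assumes "n \<ge> 1" and G: "bilinear_circuit (x_vars n) (y_vars n) G" "computes G (mat_prod_forms n)"
  shows "real (num_prod_gates G) \<ge> 3 * real n ^ 2 - 7 * real n powr (5 / 3)"
proof -
  let ?g = "{v \<in> verts (dag G). label G v = ProdGate}" and ?V = "x_vars n \<union> y_vars n"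
  have circ: "arith_circuit ?V G" using G(1) by (simp add: bilinear_circuit_def)
  then have "finite ?g"
    by (simp add: arith_circuit_def fin_digraph.finite_verts)
  have "mat_prod_forms n \<subseteq> mpoly.span (node_poly G ` ?g \<union> pvar ` ?V)"
    using G(2) node_poly_in_span[OF circ] by (fastforce simp: computes_def)
  then have "real (card (node_poly G ` ?g)) \<ge> 3 * real n ^ 2 - 7 * real n powr (5 / 3)"
    using assms(1) G(1) \<open>finite ?g\<close> prod_gate_in_bilinear_products
    by (intro card_products_ge) auto
  \<comment> \<open>Several gates may compute the same polynomial, hence only an inequality.\<close>
  moreover have "card (node_poly G ` ?g) \<le> num_prod_gates G"
    unfolding num_prod_gates_def by (intro card_image_le \<open>finite ?g\<close>)
  ultimately show ?thesis by linarith
qed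

lemma bilinear_rank_mat_prod_ge:
  assumes "n \<ge> 1"
  shows "real (bilinear_rank (x_vars n) (y_vars n)
      (mat_prod_forms n :: (mat_var, bit) mpolynomial set))
    \<ge> 3 * real n ^ 2 - 7 * real n powr (5 / 3)"
proof -
  let ?rank = "bilinear_rank (x_vars n) (y_vars n)
    (mat_prod_forms n :: (mat_var, bit) mpolynomial set)"
  \<comment> \<open>The minimum is attained because some finite set of products spans the
    forms.\<close>
  have "\<exists>P :: (mat_var, bit) mpolynomial set. P \<subseteq> bilinear_products (x_vars n) (y_vars n) \<and>
      finite P \<and> card P = ?rank \<and> mat_prod_forms n \<subseteq> mpoly.span P"
    unfolding bilinear_rank_def
    by (rule LeastI_ex) (use mat_prod_forms_finite_rank in blast)
  then obtain P :: "(mat_var, bit) mpolynomial set"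
    where "P \<subseteq> bilinear_products (x_vars n) (y_vars n)" "finite P" "card P = ?rank"
      "mat_prod_forms n \<subseteq> mpoly.span P"
    by blast
  then show ?thesis
    using card_products_ge[OF assms, of P "{}"] by simp
qed

theorem theorem1:
  shows "\<exists>C::real. \<forall>n::nat. n \<ge> 1 \<longrightarrow>
    (\<forall>G :: (nat, nat, mat_var, bit) circuit.
       bilinear_circuit (x_vars n) (y_vars n) G \<and> computes G (mat_prod_forms n) \<longrightarrow>
       real (num_prod_gates G) \<ge> 3 * real n ^ 2 - C * real n powr (5 / 3)) \<and>
    real (bilinear_rank (x_vars n) (y_vars n)
        (mat_prod_forms n :: (mat_var, bit) mpolynomial set))
      \<ge> 3 * real n ^ 2 - C * real n powr (5 / 3)"
  using num_prod_gates_ge bilinear_rank_mat_prod_ge by blast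

end
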